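(* Let $\chi\colon K^m\otimes K^n\longrightarrow K^n\otimes K^m$ be a $K$-linear map, with associated matrices $A(i,l)\in M_n(K)$ and $B(j,k)\in M_m(K)$. Then $\chi$ is a twisting map if and only if the following facts hold: (1) $\delta_{ii'}A(i,l)=A(i,l)A(i',l)$ for all $i,i',l\in\{1,\dots,m\}$; (2) $\delta_{jj'}B(j,k)=B(j,k)B(j',k)$ for all $j,j',k\in\{1,\dots,n\}$; (3) $A(i,l)\mathbf 1=\delta_{il}\mathbf 1$ for all $i,l\in\{1,\dots,m\}$; (4) $B(j,k)\mathbf 1=\delta_{jk}\mathbf 1$ for all $j,k\in\{1,\dots,n\}$.
   Context: $K$ is a field, $m,n$ are positive integers, $\otimes=\otimes_K$, and $K^m,K^n$ are the product algebras with canonical bases $\{e_1,\dots,e_m\}$ and $\{f_1,\dots,f_n\}$. The symbol $\mathbf 1$ denotes the column vector with all entries $1$ (of the appropriate size), $\delta$ is the Kronecker delta. For unital $K$-algebras $A,C$ with multiplications $\mu_A,\mu_C$ and units $\eta_A,\eta_C$, a twisting map of $C$ with $A$ is a $K$-linear map $\chi\colon C\otimes A\to A\otimes C$ such that $\chi\circ(\eta_C\otimes A)=A\otimes\eta_C$, $\chi\circ(C\otimes\eta_A)=\eta_A\otimes C$, $\chi\circ(\mu_C\otimes A)=(A\otimes\mu_C)\circ(\chi\otimes C)\circ(C\otimes\chi)$ and $\chi\circ(C\otimes\mu_A)=(\mu_A\otimes C)\circ(A\otimes\chi)\circ(\chi\otimes A)$ (here $A$, $C$ also denote identity maps). In the claim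 $C=K^m$ and $A=K^n$. For a linear map $\chi\colon K^m\otimes K^n\to K^n\otimes K^m$ let $\lambda_{ij}^{kl}\in K$ be the unique scalars with $\chi(e_i\otimes f_j)=\sum_{k,l}\lambda_{ij}^{kl}f_k\otimes e_l$. For $i,l\in\{1,\dots,m\}$ and $j,k\in\{1,\dots,n\}$ the matrices $A(i,l)\in M_n(K)$ and $B(j,k)\in M_m(K)$ are defined by $A(i,l)_{kj}=\lambda_{ij}^{kl}=B(j,k)_{li}$. *)

theory Defs
  imports "HOL-Analysis.Analysis"
begin

text \<open>
  The product algebra \<open>K\<^sup>n\<close> is the type \<open>'k ^ 'n\<close> with the library's componentwise ring
  structure; its unit is the all-ones vector \<open>1\<close> and its canonical basis is \<open>axis j 1\<close>.
  The tensor product of two coordinate spaces \<open>'k ^ 'a\<close> and \<open>'k ^ 'b\<close> is realised as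
  \<open>'k ^ ('a \<times> 'b)\<close> together with the bilinear map \<open>tensor\<close> below; the universal property is
  lemma \<open>tensor_universal\<close>.  As this tensor product is not strictly associative, the
  associativity isomorphisms are written out.
\<close>

abbreviation klinear :: "('k::field ^ 'a::finite \<Rightarrow> 'k ^ 'b::finite) \<Rightarrow> bool" where
  "klinear f \<equiv> Vector_Spaces.linear (*s) (*s) f"

definition tensor :: "'k::field ^ 'a::finite \<Rightarrow> 'k ^ 'b::finite \<Rightarrow> 'k ^ ('a \<times> 'b)"
  (infixr \<open>\<otimes>\<^sub>K\<close> 75) where
  "x \<otimes>\<^sub>K y = (\<chi> p. x $ fst p * y $ snd p)"

lemma tensor_nth [simp]: "(x \<otimes>\<^sub>K y) $ (i, j) = x $ i * y $ j"
  by (simp add: tensor_def)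

definition bilinear_into ::
  "('k::field \<Rightarrow> 'v::ab_group_add \<Rightarrow> 'v) \<Rightarrow>
   ('k ^ 'a::finite \<Rightarrow> 'k ^ 'b::finite \<Rightarrow> 'v) \<Rightarrow> bool" where
  "bilinear_into scl \<beta> \<longleftrightarrow>
     (\<forall>x. Vector_Spaces.linear (*s) scl (\<beta> x)) \<and>
     (\<forall>y. Vector_Spaces.linear (*s) scl (\<lambda>x. \<beta> x y))"

lemma vector_space_vec: "vector_space ((*s) :: 'k::field \<Rightarrow> 'k ^ 'a::finite \<Rightarrow> _)"
  by (rule vec.vector_space_axioms)

lemma tensor_add_left: "(x + x') \<otimes>\<^sub>K y = x \<otimes>\<^sub>K y + x' \<otimes>\<^sub>K y"
  and tensor_add_right: "x \<otimes>\<^sub>K (y + y') = x \<otimes>\<^sub>K y + x \<otimes>\<^sub>K y'"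
  and tensor_scale_left: "(c *s x) \<otimes>\<^sub>K y = c *s (x \<otimes>\<^sub>K y)"
  and tensor_scale_right: "x \<otimes>\<^sub>K (c *s y) = c *s (x \<otimes>\<^sub>K y)"
  by (simp_all add: vec_eq_iff distrib_left distrib_right mult_ac)

lemmas tensor_bilinear_simps =
  tensor_add_left tensor_add_right tensor_scale_left tensor_scale_right

lemma bilinear_tensor:
  "bilinear_into (*s) (tensor :: 'k::field ^ 'a::finite \<Rightarrow> 'k ^ 'b::finite \<Rightarrow> _)"
  by (simp add: bilinear_into_def Vector_Spaces.linear_iff vector_space_vec tensor_bilinear_simps)

lemma tensor_axis: "axis i 1 \<otimes>\<^sub>K axis j 1 = axis (i, j) (1 :: 'k::field)"
  by (auto simp: vec_eq_iff axis_def)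

text \<open>The linear map on the tensor product induced by a bilinear map.\<close>

definition tensor_lift ::
  "('k::field \<Rightarrow> 'v::ab_group_add \<Rightarrow> 'v) \<Rightarrow>
   ('k ^ 'a::finite \<Rightarrow> 'k ^ 'b::finite \<Rightarrow> 'v) \<Rightarrow> 'k ^ ('a \<times> 'b) \<Rightarrow> 'v" where
  "tensor_lift scl \<beta> t = (\<Sum>p\<in>UNIV. scl (t $ p) (\<beta> (axis (fst p) 1) (axis (snd p) 1)))"

lemma linear_tensor_lift:
  assumes "vector_space scl"
  shows "Vector_Spaces.linear (*s) scl (tensor_lift scl \<beta>)"
proof -
  interpret vector_space scl by fact
  show ?thesis
    by (simp add: Vector_Spaces.linear_iff vector_space_vec assms tensor_lift_def
        scale_left_distrib sum.distrib scale_sum_right)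
qed

lemma linear_expand:
  fixes x :: "'k::field ^ 'a::finite"
  assumes "Vector_Spaces.linear (*s) scl f"
  shows "f x = (\<Sum>i\<in>UNIV. scl (x $ i) (f (axis i 1)))"
proof -
  interpret Vector_Spaces.linear "(*s)" scl f by fact
  have "f x = f (\<Sum>i\<in>UNIV. x $ i *s axis i 1)" by (simp add: basis_expansion)
  also have "\<dots> = (\<Sum>i\<in>UNIV. scl (x $ i) (f (axis i 1)))" by (simp only: sum scale)
  finally show ?thesis .
qed

lemma tensor_lift_tensor:
  assumes "bilinear_into scl \<beta>"
  shows "tensor_lift scl \<beta> (x \<otimes>\<^sub>K y) = \<beta> x y"
proof -
  have l1: "Vector_Spaces.linear (*s) scl (\<beta> z)" for z
    using assms by (simp add: bilinear_into_def)
  have l2: "Vector_Spaces.linear (*s) scl (\<lambda>z. \<beta> z w)" for w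
    using assms by (simp add: bilinear_into_def)
  interpret L: Vector_Spaces.linear "(*s)" scl "\<beta> x" by (rule l1)
  have "\<beta> x y = (\<Sum>i\<in>UNIV. scl (x $ i) (\<Sum>j\<in>UNIV. scl (y $ j) (\<beta> (axis i 1) (axis j 1))))"
    using linear_expand[OF l2[of y], of x] linear_expand[OF l1, of _ y] by simp
  also have "\<dots> = (\<Sum>i\<in>UNIV. \<Sum>j\<in>UNIV. scl (x $ i * y $ j) (\<beta> (axis i 1) (axis j 1)))"
    by (simp add: L.vs2.scale_sum_right)
  also have "\<dots> = tensor_lift scl \<beta> (x \<otimes>\<^sub>K y)"
    by (simp add: tensor_lift_def sum.cartesian_product tensor_def case_prod_beta)
  finally show ?thesis by simp
qed

lemma tensor_universal:
  fixes \<beta> :: "'k::field ^ 'a::finite \<Rightarrow> 'k ^ 'b::finite \<Rightarrow> 'v::ab_group_add"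
  assumes "vector_space scl" "bilinear_into scl \<beta>"
  shows "\<exists>!g. Vector_Spaces.linear (*s) scl g \<and> (\<forall>x y. g (x \<otimes>\<^sub>K y) = \<beta> x y)"
proof (intro ex1I[of _ "tensor_lift scl \<beta>"] conjI allI)
  fix g assume g: "Vector_Spaces.linear (*s) scl g \<and> (\<forall>x y. g (x \<otimes>\<^sub>K y) = \<beta> x y)"
  show "g = tensor_lift scl \<beta>"
  proof
    fix t
    have "g t = (\<Sum>p\<in>UNIV. scl (t $ p) (g (axis p 1)))"
      using g by (intro linear_expand) simp
    also have "\<dots> = tensor_lift scl \<beta> t"
      unfolding tensor_lift_def
      by (rule sum.cong) (use g in \<open>auto simp: tensor_axis[symmetric]\<close>)
    finally show "g t = tensor_lift scl \<beta> t" .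
  qed
qed (use assms in \<open>auto simp: linear_tensor_lift tensor_lift_tensor\<close>)

definition tensor_map ::
  "('k::field ^ 'a::finite \<Rightarrow> 'k ^ 'c::finite) \<Rightarrow> ('k ^ 'b::finite \<Rightarrow> 'k ^ 'd::finite) \<Rightarrow>
   'k ^ ('a \<times> 'b) \<Rightarrow> 'k ^ ('c \<times> 'd)" where
  "tensor_map f g = tensor_lift (*s) (\<lambda>x y. f x \<otimes>\<^sub>K g y)"

lemma klinear_tensor_map: "klinear (tensor_map f g)"
  unfolding tensor_map_def by (rule linear_tensor_lift[OF vector_space_vec])

lemma tensor_map_tensor:
  assumes "klinear f" "klinear g"
  shows "tensor_map f g (x \<otimes>\<^sub>K y) = f x \<otimes>\<^sub>K g y"
  unfolding tensor_map_def
proof (rule tensor_lift_tensor)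
  show "bilinear_into (*s) (\<lambda>x y. f x \<otimes>\<^sub>K g y)"
    using assms
    by (simp add: bilinear_into_def Vector_Spaces.linear_iff vector_space_vec tensor_bilinear_simps)
qed

definition assoc ::
  "'k::field ^ (('a::finite \<times> 'b::finite) \<times> 'c::finite) \<Rightarrow> 'k ^ ('a \<times> ('b \<times> 'c))" where
  "assoc t = (\<chi> p. t $ ((fst p, fst (snd p)), snd (snd p)))"

definition assoc_inv ::
  "'k::field ^ ('a::finite \<times> ('b::finite \<times> 'c::finite)) \<Rightarrow> 'k ^ (('a \<times> 'b) \<times> 'c)" where
  "assoc_inv t = (\<chi> p. t $ (fst (fst p), (snd (fst p), snd p)))"

lemma klinear_assoc: "klinear assoc" and klinear_assoc_inv: "klinear assoc_inv"
  by (auto simp: assoc_def assoc_inv_def Vector_Spaces.linear_iff vector_space_vec vec_eq_iff)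

lemma assoc_tensor: "assoc ((x \<otimes>\<^sub>K y) \<otimes>\<^sub>K z) = x \<otimes>\<^sub>K (y \<otimes>\<^sub>K z)"
  and assoc_inv_tensor: "assoc_inv (x \<otimes>\<^sub>K (y \<otimes>\<^sub>K z)) = (x \<otimes>\<^sub>K y) \<otimes>\<^sub>K z"
  by (simp_all add: assoc_def assoc_inv_def vec_eq_iff mult.assoc)

text \<open>
  An algebra is given by its multiplication \<open>\<mu>\<close> on the tensor square and its unit \<open>\<eta>\<close>.
  In the two unit conditions the canonical isomorphisms \<open>K \<otimes> V = V = V \<otimes> K\<close> are used, so that
  \<open>\<eta> \<otimes> V\<close> is the map sending \<open>v\<close> to \<open>\<eta> 1 \<otimes> v\<close>, and \<open>V \<otimes> \<eta>\<close> sends \<open>v\<close> to \<open>v \<otimes> \<eta> 1\<close>.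
\<close>

definition twisting_map ::
  "('k ^ ('a \<times> 'a) \<Rightarrow> 'k ^ 'a) \<Rightarrow> ('k \<Rightarrow> 'k ^ 'a) \<Rightarrow>
   ('k ^ ('c \<times> 'c) \<Rightarrow> 'k ^ 'c) \<Rightarrow> ('k \<Rightarrow> 'k ^ 'c) \<Rightarrow>
   ('k::field ^ ('c::finite \<times> 'a::finite) \<Rightarrow> 'k ^ ('a \<times> 'c)) \<Rightarrow> bool" where
  "twisting_map \<mu>\<^sub>A \<eta>\<^sub>A \<mu>\<^sub>C \<eta>\<^sub>C \<tau> \<longleftrightarrow>
     klinear \<tau> \<and>
     \<tau> \<circ> (\<lambda>a. \<eta>\<^sub>C 1 \<otimes>\<^sub>K a) = (\<lambda>a. a \<otimes>\<^sub>K \<eta>\<^sub>C 1) \<and>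
     \<tau> \<circ> (\<lambda>c. c \<otimes>\<^sub>K \<eta>\<^sub>A 1) = (\<lambda>c. \<eta>\<^sub>A 1 \<otimes>\<^sub>K c) \<and>
     \<tau> \<circ> tensor_map \<mu>\<^sub>C id =
       tensor_map id \<mu>\<^sub>C \<circ> assoc \<circ> tensor_map \<tau> id \<circ> assoc_inv \<circ> tensor_map id \<tau> \<circ> assoc \<and>
     \<tau> \<circ> tensor_map id \<mu>\<^sub>A =
       tensor_map \<mu>\<^sub>A id \<circ> assoc_inv \<circ> tensor_map id \<tau> \<circ> assoc \<circ> tensor_map \<tau> id \<circ> assoc_inv"

definition prod_mult :: "'k::field ^ ('a::finite \<times> 'a) \<Rightarrow> 'k ^ 'a" where
  "prod_mult = tensor_lift (*s) (*)"

lemma prod_mult_tensor: "prod_mult (x \<otimes>\<^sub>K y) = x * y"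
  unfolding prod_mult_def
  by (rule tensor_lift_tensor)
    (simp add: bilinear_into_def Vector_Spaces.linear_iff vector_space_vec vec_eq_iff
      distrib_left distrib_right mult_ac)

text \<open>The unit map of \<open>K\<^sup>n\<close> is the library's diagonal map \<open>vec\<close>.\<close>

definition is_twisting_map_K ::
  "('k::field ^ ('m::finite \<times> 'n::finite) \<Rightarrow> 'k ^ ('n \<times> 'm)) \<Rightarrow> bool" where
  "is_twisting_map_K = twisting_map prod_mult vec prod_mult vec"

text \<open>\<open>twist_coeff \<tau> i j k l\<close> is the scalar \<open>\<lambda>\<^bsub>ij\<^esub>\<^bsup>kl\<^esup>\<close>.\<close>

definition twist_coeff ::
  "('k::field ^ ('m::finite \<times> 'n::finite) \<Rightarrow> 'k ^ ('n \<times> 'm)) \<Rightarrow> 'm \<Rightarrow> 'n \<Rightarrow> 'n \<Rightarrow> 'm \<Rightarrow> 'k" where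
  "twist_coeff \<tau> = (THE c. \<forall>i j. \<tau> (axis i 1 \<otimes>\<^sub>K axis j 1) =
     (\<Sum>k\<in>UNIV. \<Sum>l\<in>UNIV. c i j k l *s (axis k 1 \<otimes>\<^sub>K axis l 1)))"

lemma tensor_basis_sum_nth:
  fixes c :: "'n::finite \<Rightarrow> 'm::finite \<Rightarrow> 'k::field"
  shows "(\<Sum>k\<in>UNIV. \<Sum>l\<in>UNIV. c k l *s (axis k 1 \<otimes>\<^sub>K axis l 1)) $ (k', l') = c k' l'"
proof -
  have "(\<Sum>k\<in>UNIV. \<Sum>l\<in>UNIV. c k l *s (axis k 1 \<otimes>\<^sub>K axis l 1)) $ (k', l') =
      (\<Sum>k\<in>UNIV. \<Sum>l\<in>UNIV. if l = l' then (if k = k' then c k l' else 0) else 0)"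
    unfolding sum_component by (intro sum.cong refl) (auto simp: axis_def)
  then show ?thesis by simp
qed

lemma tensor_basis_sum_eq:
  "v = (\<Sum>k\<in>UNIV. \<Sum>l\<in>UNIV. c k l *s (axis k 1 \<otimes>\<^sub>K axis l (1 :: 'k::field))) \<longleftrightarrow>
     (\<forall>k l. v $ (k, l) = c k l)"
  unfolding vec_eq_iff split_paired_All tensor_basis_sum_nth by (rule refl)

lemma twist_coeff_unique:
  "\<exists>!c. \<forall>i j. \<tau> (axis i 1 \<otimes>\<^sub>K axis j 1) =
     (\<Sum>k\<in>UNIV. \<Sum>l\<in>UNIV. c i j k l *s (axis k 1 \<otimes>\<^sub>K axis l (1 :: 'k::field)))"
  unfolding tensor_basis_sum_eq
proof (rule ex1I[of _ "\<lambda>i j k l. \<tau> (axis i 1 \<otimes>\<^sub>K axis j 1) $ (k, l)"])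
  fix c assume "\<forall>i j k l. \<tau> (axis i 1 \<otimes>\<^sub>K axis j 1) $ (k, l) = c i j k l"
  then show "c = (\<lambda>i j k l. \<tau> (axis i 1 \<otimes>\<^sub>K axis j 1) $ (k, l))"
    by (intro ext) (rule sym, blast)
qed (intro allI refl)

lemma twist_coeff_eq: "twist_coeff \<tau> i j k l = \<tau> (axis i 1 \<otimes>\<^sub>K axis j 1) $ (k, l)"
  by (rule sym, rule theI'[OF twist_coeff_unique[of \<tau>], folded twist_coeff_def,
      unfolded tensor_basis_sum_eq, rule_format])

definition matA ::
  "('k::field ^ ('m::finite \<times> 'n::finite) \<Rightarrow> 'k ^ ('n \<times> 'm)) \<Rightarrow> 'm \<Rightarrow> 'm \<Rightarrow> 'k ^ 'n ^ 'n" where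
  "matA \<tau> i l = (\<chi> k j. twist_coeff \<tau> i j k l)"

definition matB ::
  "('k::field ^ ('m::finite \<times> 'n::finite) \<Rightarrow> 'k ^ ('n \<times> 'm)) \<Rightarrow> 'n \<Rightarrow> 'n \<Rightarrow> 'k ^ 'm ^ 'm" where
  "matB \<tau> j k = (\<chi> l i. twist_coeff \<tau> i j k l)"

end

theory Submission
  imports Defs
begin

text \<open>
  Write \<open>c i j k l\<close> for the coefficients \<open>twist_coeff \<tau> i j k l\<close>.  Both sides of each axiom of a
  twisting map are linear, so the axiom amounts to equality of all coordinates on a basis, and
  the claim is that these coordinates are the entries of the four matrix identities.

  The unit axioms compare \<open>\<tau> (1 \<otimes> f\<^sub>j)\<close> with \<open>f\<^sub>j \<otimes> 1\<close> and \<open>\<tau> (e\<^sub>i \<otimes> 1)\<close> with \<open>1 \<otimes> e\<^sub>i\<close>.  As the unit is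
  the sum of the basis vectors, their coordinates are the row sums of \<open>matB \<tau> j k\<close> and
  \<open>matA \<tau> i l\<close> respectively.

  For the axiom about the multiplication of \<open>K\<^sup>m\<close>, the left side sends \<open>(e\<^sub>i \<otimes> e\<^sub>i\<^sub>') \<otimes> f\<^sub>j\<close> to
  \<open>\<tau> (e\<^sub>i \<otimes> f\<^sub>j)\<close> if \<open>i = i'\<close> and to \<open>0\<close> otherwise, because the \<open>e\<^sub>i\<close> are orthogonal idempotents.
  On the right side the two applications of \<open>\<tau>\<close> produce two basis vectors of \<open>K\<^sup>m\<close>, which are
  multiplied at the end and so must agree.  Only the index of \<open>K\<^sup>n\<close> between the two applications
  is summed over, so the coordinate at \<open>(k, l)\<close> is \<open>\<Sum>p. c i p k l * c i' j p l\<close>, which is an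
  entry of \<open>matA \<tau> i l ** matA \<tau> i' l\<close> (\<open>mult_C_iff_coeff\<close>).  For the multiplication of \<open>K\<^sup>n\<close>
  the two output indices in \<open>K\<^sup>n\<close> must agree and the index of \<open>K\<^sup>m\<close> is summed over, which gives
  a product of matrices \<open>matB\<close> (\<open>mult_A_iff_coeff\<close>).
\<close>

lemma klinear_nth:
  assumes "klinear f"
  shows "f x $ k = (\<Sum>i\<in>UNIV. x $ i * f (axis i 1) $ k)"
  by (subst linear_expand[OF assms]) simp

lemma klinear_eq_iff_axis:
  assumes "klinear f" "klinear g"
  shows "f = g \<longleftrightarrow> (\<forall>i. f (axis i 1) = g (axis i 1))"
proof
  assume "\<forall>i. f (axis i 1) = g (axis i 1)"
  then have "f x = g x" for x
    unfolding linear_expand[OF assms(1), of x] linear_expand[OF assms(2), of x] by simp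
  then show "f = g" ..
qed simp

lemma klinear_id: "klinear id"
  by (simp add: Vector_Spaces.linear_iff vector_space_vec)

lemma klinear_compose: "klinear f \<Longrightarrow> klinear g \<Longrightarrow> klinear (g \<circ> f)"
  by (rule Vector_Spaces.linear_compose)

lemma klinear_prod_mult: "klinear prod_mult"
  unfolding prod_mult_def by (rule linear_tensor_lift[OF vector_space_vec])

lemma klinear_tensor_left: "klinear (\<lambda>x. x \<otimes>\<^sub>K y)"
  and klinear_tensor_right: "klinear (\<lambda>y. x \<otimes>\<^sub>K y)"
  by (simp_all add: Vector_Spaces.linear_iff vector_space_vec tensor_bilinear_simps)

lemma sum_UNIV_prod:
  fixes f :: "'a::finite \<times> 'b::finite \<Rightarrow> 'c::comm_monoid_add"
  shows "(\<Sum>p\<in>UNIV. f p) = (\<Sum>a\<in>UNIV. \<Sum>b\<in>UNIV. f (a, b))"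
  by (simp add: sum.cartesian_product)

lemma sum_axis_mult:
  fixes f :: "'a::finite \<Rightarrow> 'k::field"
  shows "(\<Sum>i\<in>UNIV. axis a 1 $ i * f i) = f a"
    and "(\<Sum>i\<in>UNIV. axis i 1 $ a * f i) = f a"
    and "(\<Sum>i\<in>UNIV. f i * axis i 1 $ a) = f a"
  by (simp_all add: axis_def if_distrib[of "\<lambda>x. x * _"] if_distrib[of "\<lambda>x. _ * x"] cong: if_cong)

lemma prod_mult_nth: "prod_mult t $ i = t $ (i, i)"
  unfolding prod_mult_def tensor_lift_def
  by (simp add: sum_UNIV_prod mult.left_commute[of "t $ _"] sum_distrib_left[symmetric] sum_axis_mult)

text \<open>
  A map that acts on one tensor factor only acts separately on each slice in the other index.
  This lets a composite of such maps be evaluated one coordinate at a time.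
\<close>

lemma tensor_map_id_left_nth:
  assumes "klinear g"
  shows "tensor_map id g t $ (a, b) = g (\<chi> y. t $ (a, y)) $ b"
  unfolding klinear_nth[OF assms, of "\<chi> y. t $ (a, y)"] tensor_map_def tensor_lift_def
  by (simp add: sum_UNIV_prod mult.left_commute[of "t $ _"] sum_distrib_left[symmetric] sum_axis_mult)

lemma tensor_map_id_right_nth:
  assumes "klinear f"
  shows "tensor_map f id t $ (a, b) = f (\<chi> x. t $ (x, b)) $ a"
  unfolding klinear_nth[OF assms, of "\<chi> x. t $ (x, b)"] tensor_map_def tensor_lift_def
  by (simp add: sum_UNIV_prod mult.assoc[symmetric] sum_axis_mult)

lemma assoc_nth: "assoc t $ (a, b, c) = t $ ((a, b), c)"
  and assoc_inv_nth: "assoc_inv u $ ((a, b), c) = u $ (a, b, c)"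
  by (simp_all add: assoc_def assoc_inv_def)

lemma twist_nth:
  assumes "klinear \<tau>"
  shows "\<tau> t $ (k, l) = (\<Sum>i\<in>UNIV. \<Sum>j\<in>UNIV. t $ (i, j) * twist_coeff \<tau> i j k l)"
  by (simp add: klinear_nth[OF assms, of t] sum_UNIV_prod twist_coeff_eq tensor_axis)

lemma unit_C_iff_coeff:
  assumes "klinear \<tau>"
  shows "\<tau> \<circ> (\<lambda>a. vec 1 \<otimes>\<^sub>K a) = (\<lambda>a. a \<otimes>\<^sub>K vec 1) \<longleftrightarrow>
    (\<forall>j k l. (\<Sum>i\<in>UNIV. twist_coeff \<tau> i j k l) = (if j = k then 1 else 0))"
    (is "?L = ?R \<longleftrightarrow> _")
proof -
  have lin: "klinear ?L" "klinear ?R"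
    by (intro klinear_compose klinear_tensor_left klinear_tensor_right assms)+
  have left: "?L (axis j 1) $ (k, l) = (\<Sum>i\<in>UNIV. twist_coeff \<tau> i j k l)" for j k l
    by (simp add: twist_nth[OF assms] sum_axis_mult)
  have right: "?R (axis j 1) $ (k, l) = (if j = k then 1 else 0)" for j k l
    by (simp add: axis_def)
  show ?thesis
    unfolding klinear_eq_iff_axis[OF lin] vec_eq_iff split_paired_All left right by (rule refl)
qed

lemma unit_A_iff_coeff:
  assumes "klinear \<tau>"
  shows "\<tau> \<circ> (\<lambda>c. c \<otimes>\<^sub>K vec 1) = (\<lambda>c. vec 1 \<otimes>\<^sub>K c) \<longleftrightarrow>
    (\<forall>i k l. (\<Sum>j\<in>UNIV. twist_coeff \<tau> i j k l) = (if i = l then 1 else 0))"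
    (is "?L = ?R \<longleftrightarrow> _")
proof -
  have lin: "klinear ?L" "klinear ?R"
    by (intro klinear_compose klinear_tensor_left klinear_tensor_right assms)+
  have left: "?L (axis i 1) $ (k, l) = (\<Sum>j\<in>UNIV. twist_coeff \<tau> i j k l)" for i k l
    by (simp add: twist_nth[OF assms] sum_distrib_left[symmetric] sum_axis_mult)
  have right: "?R (axis i 1) $ (k, l) = (if i = l then 1 else 0)" for i k l
    by (simp add: axis_def)
  show ?thesis
    unfolding klinear_eq_iff_axis[OF lin] vec_eq_iff split_paired_All left right by (rule refl)
qed

lemma prod_mult_axis:
  "prod_mult (axis (i, i') 1) = (if i = i' then axis i 1 else (0 :: 'k::field ^ 'a::finite))"
  by (auto simp: vec_eq_iff prod_mult_nth axis_def)

text \<open>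
  Multiplying in \<open>K\<^sup>m\<close> picks out the diagonal \<open>(l, l)\<close> of the two output indices in \<open>K\<^sup>m\<close>, so both
  factors of the sum carry the same \<open>l\<close>.  The index \<open>p\<close> is the state of the vector of \<open>K\<^sup>n\<close> after it
  has passed \<open>e\<^sub>i\<^sub>'\<close> and before it passes \<open>e\<^sub>i\<close>.
\<close>

lemma mult_C_iff_coeff:
  fixes \<tau> :: "'k::field ^ ('m::finite \<times> 'n::finite) \<Rightarrow> 'k ^ ('n \<times> 'm)"
  assumes "klinear \<tau>"
  shows "\<tau> \<circ> tensor_map prod_mult id =
      tensor_map id prod_mult \<circ> assoc \<circ> tensor_map \<tau> id \<circ> assoc_inv \<circ> tensor_map id \<tau> \<circ> assoc \<longleftrightarrow>
    (\<forall>i i' j k l. (if i = i' then twist_coeff \<tau> i j k l else 0) =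
      (\<Sum>p\<in>UNIV. twist_coeff \<tau> i p k l * twist_coeff \<tau> i' j p l))"
    (is "?L = ?R \<longleftrightarrow> _")
proof -
  have lin: "klinear ?L" "klinear ?R"
    by (intro klinear_compose klinear_tensor_map klinear_assoc klinear_assoc_inv assms)+
  have left: "?L (axis ((i, i'), j) 1) $ (k, l) = (if i = i' then twist_coeff \<tau> i j k l else 0)"
    for i i' j k l
    unfolding tensor_axis[symmetric, of "(i, i')"]
    by (simp add: tensor_map_tensor klinear_prod_mult klinear_id[unfolded id_def] id_def
        prod_mult_axis twist_nth[OF assms] sum_axis_mult mult.assoc sum_distrib_left[symmetric])
  have right: "?R (axis ((i, i'), j) 1) $ (k, l) =
      (\<Sum>p\<in>UNIV. twist_coeff \<tau> i p k l * twist_coeff \<tau> i' j p l)" for i i' j k l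
    unfolding tensor_axis[symmetric]
    by (simp add: tensor_map_id_left_nth tensor_map_id_right_nth klinear_prod_mult assms
        prod_mult_nth assoc_nth assoc_inv_nth assoc_tensor tensor_map_tensor klinear_id
        twist_nth[OF assms] sum_axis_mult mult.assoc sum_distrib_left[symmetric])
      (simp add: mult.commute)
  show ?thesis
    unfolding klinear_eq_iff_axis[OF lin] vec_eq_iff split_paired_All left right by blast
qed

text \<open>
  Here the diagonal is \<open>(k, k)\<close> in \<open>K\<^sup>n\<close>, and \<open>q\<close> is the state of the vector of \<open>K\<^sup>m\<close> after it has
  passed \<open>f\<^sub>j\<close> and before it passes \<open>f\<^sub>j\<^sub>'\<close>.
\<close>

lemma mult_A_iff_coeff:
  fixes \<tau> :: "'k::field ^ ('m::finite \<times> 'n::finite) \<Rightarrow> 'k ^ ('n \<times> 'm)"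
  assumes "klinear \<tau>"
  shows "\<tau> \<circ> tensor_map id prod_mult =
      tensor_map prod_mult id \<circ> assoc_inv \<circ> tensor_map id \<tau> \<circ> assoc \<circ> tensor_map \<tau> id \<circ> assoc_inv \<longleftrightarrow>
    (\<forall>i j j' k l. (if j = j' then twist_coeff \<tau> i j k l else 0) =
      (\<Sum>q\<in>UNIV. twist_coeff \<tau> q j' k l * twist_coeff \<tau> i j k q))"
    (is "?L = ?R \<longleftrightarrow> _")
proof -
  have lin: "klinear ?L" "klinear ?R"
    by (intro klinear_compose klinear_tensor_map klinear_assoc klinear_assoc_inv assms)+
  have left: "?L (axis (i, j, j') 1) $ (k, l) = (if j = j' then twist_coeff \<tau> i j k l else 0)"
    for i j j' k l
    unfolding tensor_axis[symmetric, of i]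
    by (simp add: tensor_map_tensor klinear_prod_mult klinear_id[unfolded id_def] id_def
        prod_mult_axis twist_nth[OF assms] sum_axis_mult mult.assoc sum_distrib_left[symmetric])
  have right: "?R (axis (i, j, j') 1) $ (k, l) =
      (\<Sum>q\<in>UNIV. twist_coeff \<tau> q j' k l * twist_coeff \<tau> i j k q)" for i j j' k l
    unfolding tensor_axis[symmetric]
    by (simp add: tensor_map_id_left_nth tensor_map_id_right_nth klinear_prod_mult assms
        prod_mult_nth assoc_nth assoc_inv_nth assoc_inv_tensor tensor_map_tensor klinear_id
        twist_nth[OF assms] sum_axis_mult mult.assoc sum_distrib_left[symmetric])
      (simp add: mult.commute)
  show ?thesis
    unfolding klinear_eq_iff_axis[OF lin] vec_eq_iff split_paired_All left right by blast
qed

theorem proposition2p3: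
  fixes \<tau> :: "'k::field ^ ('m::finite \<times> 'n::finite) \<Rightarrow> 'k ^ ('n \<times> 'm)"
  assumes "klinear \<tau>"
  shows "is_twisting_map_K \<tau> \<longleftrightarrow>
     (\<forall>i i' l. (if i = i' then matA \<tau> i l else 0) = matA \<tau> i l ** matA \<tau> i' l) \<and>
     (\<forall>j j' k. (if j = j' then matB \<tau> j k else 0) = matB \<tau> j k ** matB \<tau> j' k) \<and>
     (\<forall>i l. matA \<tau> i l *v 1 = (if i = l then 1 else 0)) \<and>
     (\<forall>j k. matB \<tau> j k *v 1 = (if j = k then 1 else 0))"
proof -
  let ?c = "twist_coeff \<tau>"
  have A_mult: "(if i = i' then matA \<tau> i l else 0) = matA \<tau> i l ** matA \<tau> i' l \<longleftrightarrow>
      (\<forall>k j. (if i = i' then ?c i j k l else 0) = (\<Sum>p\<in>UNIV. ?c i p k l * ?c i' j p l))"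
    for i i' l
    by (simp add: vec_eq_iff matrix_matrix_mult_def matA_def)
  \<comment> \<open>The basis vector that passes through \<open>\<tau>\<close> first contributes the right factor.  In the axiom
    for \<open>K\<^sup>n\<close> this is \<open>f\<^sub>j\<close>, the left vector of \<open>f\<^sub>j \<otimes> f\<^sub>j\<^sub>'\<close>, so \<open>j\<close> and \<open>j'\<close> are exchanged here; for
    \<open>K\<^sup>m\<close> it is the right vector \<open>e\<^sub>i\<^sub>'\<close> and the order is kept.\<close>
  have B_mult: "(if j = j' then matB \<tau> j k else 0) = matB \<tau> j k ** matB \<tau> j' k \<longleftrightarrow>
      (\<forall>l i. (if j' = j then ?c i j' k l else 0) = (\<Sum>q\<in>UNIV. ?c q j k l * ?c i j' k q))"
    for j j' k
    by (cases "j = j'") (simp_all add: vec_eq_iff matrix_matrix_mult_def matB_def)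
  have A_unit: "matA \<tau> i l *v 1 = (if i = l then 1 else 0) \<longleftrightarrow>
      (\<forall>k. (\<Sum>j\<in>UNIV. ?c i j k l) = (if i = l then 1 else 0))" for i l
    by (simp add: vec_eq_iff matrix_vector_mult_def matA_def)
  have B_unit: "matB \<tau> j k *v 1 = (if j = k then 1 else 0) \<longleftrightarrow>
      (\<forall>l. (\<Sum>i\<in>UNIV. ?c i j k l) = (if j = k then 1 else 0))" for j k
    by (simp add: vec_eq_iff matrix_vector_mult_def matB_def)
  show ?thesis
    unfolding is_twisting_map_K_def twisting_map_def unit_C_iff_coeff[OF assms]
      unit_A_iff_coeff[OF assms] mult_C_iff_coeff[OF assms] mult_A_iff_coeff[OF assms]
      A_mult B_mult A_unit B_unit
    using assms by (simp only: simp_thms) blast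
qed

end
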